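(* Let $\lambda>0$. Let $g:\mathbb{R}^m\to\mathbb{R}$ be a seminorm which is not identically zero and let $h:\mathbb{R}^n\to\mathbb{R}$ be a norm. Then for any $\mathbf{z}\in\mathbb{R}^m$ and $\boldsymbol\beta\in\mathbb{R}^n$, $$\max_{\boldsymbol\Delta\in\mathcal{U}_{(h,g)}} g(\mathbf{z}+\boldsymbol\Delta\boldsymbol\beta) = g(\mathbf{z})+\lambda h(\boldsymbol\beta),$$ where $\mathcal{U}_{(h,g)} = \{\boldsymbol\Delta\in\mathbb{R}^{m\times n}:\|\boldsymbol\Delta\|_{(h,g)}\leq \lambda\}$.
   Context: A seminorm is a real-valued function on a real vector space that is absolutely homogeneous and satisfies the triangle inequality (norms are included). For a seminorm $g$ on $\mathbb{R}^m$ and a norm $h$ on $\mathbb{R}^n$, the induced (semi)norm of $\boldsymbol\Delta\in\mathbb{R}^{m\times n}$ is $\|\boldsymbol\Delta\|_{(h,g)}:=\max_{\boldsymbol\beta\in\mathbb{R}^n,\,\boldsymbol\beta\ne 0} g(\boldsymbol\Delta\boldsymbol\beta)/h(\boldsymbol\beta)$, so $\boldsymbol\Delta\in\mathcal{U}_{(h,g)}$ if and only if $g(\boldsymbol\Delta\mathbf{x})\le\lambda h(\mathbf{x})$ for all $\mathbf{x}\in\mathbb{R}^n$. The maximum is asserted to be attained. *)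

theory Defs
  imports "HOL-Analysis.Analysis"
begin

definition is_seminorm :: "('a::real_vector \<Rightarrow> real) \<Rightarrow> bool" where
  "is_seminorm f \<longleftrightarrow>
     (\<forall>c x. f (c *\<^sub>R x) = \<bar>c\<bar> * f x) \<and> (\<forall>x y. f (x + y) \<le> f x + f y)"

definition is_norm :: "('a::real_vector \<Rightarrow> real) \<Rightarrow> bool" where
  "is_norm f \<longleftrightarrow> is_seminorm f \<and> (\<forall>x. f x = 0 \<longrightarrow> x = 0)"

definition is_maximum :: "real set \<Rightarrow> real \<Rightarrow> bool" where
  "is_maximum S M \<longleftrightarrow> M \<in> S \<and> (\<forall>x\<in>S. x \<le> M)"

(* The description operator is total; that the maximum really exists when g is a seminorm
   and h a norm is lemma induced_norm_is_maximum below. *)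
definition induced_norm ::
  "(real ^ 'n \<Rightarrow> real) \<Rightarrow> (real ^ 'm \<Rightarrow> real) \<Rightarrow> real ^ 'n ^ 'm \<Rightarrow> real" where
  "induced_norm h g \<Delta> = (THE M. is_maximum {g (\<Delta> *v \<beta>) / h \<beta> | \<beta>. \<beta> \<noteq> 0} M)"

definition uncertainty_set ::
  "real \<Rightarrow> (real ^ 'n \<Rightarrow> real) \<Rightarrow> (real ^ 'm \<Rightarrow> real) \<Rightarrow> (real ^ 'n ^ 'm) set" where
  "uncertainty_set lam h g = {\<Delta>. induced_norm h g \<Delta> \<le> lam}"

lemma is_maximum_unique: "is_maximum S M \<Longrightarrow> is_maximum S N \<Longrightarrow> M = N"
  by (auto simp: is_maximum_def intro: antisym)

lemma is_seminorm_zero: "is_seminorm f \<Longrightarrow> f 0 = 0"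
  unfolding is_seminorm_def by (metis abs_zero mult_zero_left scale_zero_left)

lemma is_seminorm_nonneg:
  assumes "is_seminorm f" shows "0 \<le> f x"
proof -
  have "f ((-1) *\<^sub>R x) = f x"
    using assms unfolding is_seminorm_def by (simp only: abs_minus_cancel abs_one mult_1 simp_thms)
  moreover have "f (x + (-1) *\<^sub>R x) \<le> f x + f ((-1) *\<^sub>R x)"
    using assms unfolding is_seminorm_def by blast
  ultimately show ?thesis using is_seminorm_zero[OF assms] by simp
qed

lemma is_seminorm_continuous_on:
  fixes f :: "'a::euclidean_space \<Rightarrow> real"
  assumes "is_seminorm f" shows "continuous_on S f"
proof -
  have "convex_on UNIV f"
  proof (rule convex_onI)
    fix t :: real and x y :: 'a assume t: "0 < t" "t < 1"
    have "f ((1 - t) *\<^sub>R x + t *\<^sub>R y) \<le> f ((1 - t) *\<^sub>R x) + f (t *\<^sub>R y)"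
      using assms unfolding is_seminorm_def by blast
    also have "\<dots> = \<bar>1 - t\<bar> * f x + \<bar>t\<bar> * f y"
      using assms unfolding is_seminorm_def by simp
    finally show "f ((1 - t) *\<^sub>R x + t *\<^sub>R y) \<le> (1 - t) * f x + t * f y"
      using t by simp
  qed simp
  then have "continuous_on UNIV f"
    by (intro convex_on_continuous) auto
  then show ?thesis by (rule continuous_on_subset) simp
qed

lemma is_norm_pos: "is_norm h \<Longrightarrow> x \<noteq> 0 \<Longrightarrow> 0 < h x"
  unfolding is_norm_def using is_seminorm_nonneg[of h x] by (metis less_eq_real_def)

lemma induced_norm_is_maximum:
  fixes g :: "real ^ 'm \<Rightarrow> real" and h :: "real ^ 'n \<Rightarrow> real" and \<Delta> :: "real ^ 'n ^ 'm"
  assumes g: "is_seminorm g" and h: "is_norm h"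
  shows "is_maximum {g (\<Delta> *v \<beta>) / h \<beta> | \<beta>. \<beta> \<noteq> 0} (induced_norm h g \<Delta>)"
proof -
  let ?q = "\<lambda>x. g (\<Delta> *v x) / h x"
  let ?S = "sphere (0 :: real ^ 'n) 1"
  have sh: "is_seminorm h" using h by (simp add: is_norm_def)
  have "continuous_on ?S (\<lambda>x. g (\<Delta> *v x))"
    by (rule continuous_on_compose2[OF is_seminorm_continuous_on[OF g, of UNIV]])
      (auto intro: linear_continuous_on)
  moreover have "h x \<noteq> 0" if "x \<in> ?S" for x
  proof -
    have "x \<noteq> 0" using that by auto
    then show ?thesis using is_norm_pos[OF h, of x] by simp
  qed
  ultimately have "continuous_on ?S ?q"
    using is_seminorm_continuous_on[OF sh] by (intro continuous_on_divide) auto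
  moreover have "?S \<noteq> {}" by simp
  ultimately have "\<exists>u\<in>?S. \<forall>y\<in>?S. ?q y \<le> ?q u"
    by (intro continuous_attains_sup[OF compact_sphere])
  then obtain u where u: "u \<in> ?S" "\<And>y. y \<in> ?S \<Longrightarrow> ?q y \<le> ?q u"
    by blast
  have "?q x \<le> ?q u" if "x \<noteq> 0" for x
  proof -
    let ?c = "inverse (norm x)"
    have c: "?c > 0" using that by simp
    have "g (\<Delta> *v (?c *\<^sub>R x)) = ?c * g (\<Delta> *v x)" "h (?c *\<^sub>R x) = ?c * h x"
      using g sh c unfolding is_seminorm_def
      by (simp_all add: matrix_vector_mult_scaleR)
    then have "?q x = ?q (?c *\<^sub>R x)" using that by simp
    also have "\<dots> \<le> ?q u" using that by (intro u(2)) simp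
    finally show ?thesis .
  qed
  moreover have "u \<noteq> 0" using u(1) by auto
  ultimately have "is_maximum {?q \<beta> | \<beta>. \<beta> \<noteq> 0} (?q u)"
    unfolding is_maximum_def by auto
  then show ?thesis
    unfolding induced_norm_def by (rule theI) (erule is_maximum_unique, fact)
qed

lemma mem_uncertainty_set_iff:
  fixes g :: "real ^ 'm \<Rightarrow> real" and h :: "real ^ 'n \<Rightarrow> real"
  assumes g: "is_seminorm g" and h: "is_norm h"
  shows "\<Delta> \<in> uncertainty_set lam h g \<longleftrightarrow> (\<forall>x. g (\<Delta> *v x) \<le> lam * h x)"
proof -
  have sh: "is_seminorm h" using h by (simp add: is_norm_def)
  have "induced_norm h g \<Delta> \<le> lam \<longleftrightarrow> (\<forall>x. x \<noteq> 0 \<longrightarrow> g (\<Delta> *v x) / h x \<le> lam)"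
    using induced_norm_is_maximum[OF g h, of \<Delta>] unfolding is_maximum_def
    by (auto intro: order_trans)
  also have "\<dots> \<longleftrightarrow> (\<forall>x. x \<noteq> 0 \<longrightarrow> g (\<Delta> *v x) \<le> lam * h x)"
    using is_norm_pos[OF h] by (simp add: pos_divide_le_eq)
  also have "\<dots> \<longleftrightarrow> (\<forall>x. g (\<Delta> *v x) \<le> lam * h x)"
    using is_seminorm_zero[OF g] is_seminorm_zero[OF sh]
    by (metis matrix_vector_mult_0_right mult_zero_right order_refl)
  finally show ?thesis by (simp add: uncertainty_set_def)
qed

end

(* By Hahn-Banach there is a vector p dual to \<beta>, that is p \<bullet> x \<le> h x for all x with equality at \<beta>.
   Choose u with g u = 1 along which g grows at unit rate from z (the direction of z if g z > 0,
   any direction otherwise). The triangle inequality gives the upper bound, and the rank-one matrix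
   lam * u p^T attains it. *)
theory Submission
  imports Defs
begin

lemma is_seminorm_scaleR: "is_seminorm f \<Longrightarrow> f (c *\<^sub>R x) = \<bar>c\<bar> * f x"
  unfolding is_seminorm_def by blast

lemma is_seminorm_triangle: "is_seminorm f \<Longrightarrow> f (x + y) \<le> f x + f y"
  unfolding is_seminorm_def by blast

lemma is_seminorm_minus: "is_seminorm f \<Longrightarrow> f (- x) = f x"
  using is_seminorm_scaleR[of f "-1" x] by simp

lemma convex_is_seminorm_ball:
  assumes "is_seminorm f"
  shows "convex {x. f x < r}"
proof (rule convexI)
  fix x y and u v :: real
  assume xy: "x \<in> {x. f x < r}" "y \<in> {x. f x < r}" and uv: "0 \<le> u" "0 \<le> v" "u + v = 1"
  have "f (u *\<^sub>R x + v *\<^sub>R y) \<le> u * f x + v * f y"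
    using is_seminorm_triangle[OF assms, of "u *\<^sub>R x" "v *\<^sub>R y"] uv
    by (simp add: is_seminorm_scaleR[OF assms])
  also have "\<dots> < r"
    using xy uv by (intro convex_bound_lt) auto
  finally show "u *\<^sub>R x + v *\<^sub>R y \<in> {x. f x < r}" by simp
qed

text \<open>Finite-dimensional Hahn-Banach: a hyperplane separates \<open>y\<close> from the convex
  set where \<open>f\<close> is below \<open>f y\<close>, and its normal, rescaled to take the value
  \<open>f y\<close> at \<open>y\<close>, is \<open>p\<close>. The absolute value comes from the
  symmetry of \<open>f\<close>.\<close>

lemma is_seminorm_supporting_functional:
  fixes f :: "'a::euclidean_space \<Rightarrow> real"
  assumes f: "is_seminorm f"
  obtains p where "p \<bullet> y = f y" "\<And>x. \<bar>p \<bullet> x\<bar> \<le> f x"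
proof (cases "f y = 0")
  case True
  \<comment> \<open>Here the set to separate from would be empty, but the zero functional already
    works.\<close>
  then show ?thesis using that[of 0] is_seminorm_nonneg[OF f] by simp
next
  case False
  then have pos: "f y > 0" using is_seminorm_nonneg[OF f, of y] by simp
  then have "{x. f x < f y} \<noteq> {}"
    using is_seminorm_zero[OF f] by (auto intro: exI[of _ 0])
  then obtain a b where a: "a \<noteq> 0" "\<And>x. f x < f y \<Longrightarrow> a \<bullet> x \<le> b" "b \<le> a \<bullet> y"
    using separating_hyperplane_sets[OF convex_is_seminorm_ball[OF f] convex_singleton[of y], of "f y"]
    by auto
  \<comment> \<open>Homogeneity turns the bound on the ball into one for all \<open>x\<close>.
    Dividing by some \<open>s\<close> strictly above \<open>f x\<close>, rather than by
    \<open>f x\<close>, keeps the scaling defined when \<open>f x = 0\<close>.\<close>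
  have scaled: "f y * (a \<bullet> x) \<le> s * (a \<bullet> y)" if "f x < s" for x s
  proof -
    have s: "s > 0" using that is_seminorm_nonneg[OF f, of x] by simp
    have "f ((f y / s) *\<^sub>R x) < f y"
      using s pos that by (simp add: is_seminorm_scaleR[OF f] field_simps)
    then have "a \<bullet> ((f y / s) *\<^sub>R x) \<le> a \<bullet> y" using a(2,3) by fastforce
    then show ?thesis using s by (simp add: field_simps)
  qed
  \<comment> \<open>Testing the bound on the normal \<open>a\<close> itself shows that
    \<open>a \<bullet> y\<close> is positive, so \<open>a\<close> can be normalised.\<close>
  have "0 < f y * (a \<bullet> a)" using pos a(1) by simp
  also have "\<dots> \<le> (f a + 1) * (a \<bullet> y)" by (rule scaled) simp
  finally have ay: "a \<bullet> y > 0"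
    using is_seminorm_nonneg[OF f, of a] by (simp add: zero_less_mult_iff)
  define p where "p = (f y / (a \<bullet> y)) *\<^sub>R a"
  have le: "p \<bullet> x \<le> f x" for x
  \<comment> \<open>Letting \<open>s\<close> decrease to \<open>f x\<close> removes the slack in
    \<open>scaled\<close>.\<close>
  proof (rule dense_ge)
    fix s assume "f x < s"
    then show "p \<bullet> x \<le> s" using scaled[of x s] ay by (simp add: p_def field_simps)
  qed
  have "\<bar>p \<bullet> x\<bar> \<le> f x" for x
    using le[of x] le[of "- x"] by (simp add: is_seminorm_minus[OF f])
  moreover have "p \<bullet> y = f y" using ay by (simp add: p_def)
  ultimately show ?thesis using that by blast
qed

text \<open>Provides equality in the triangle inequality: along its own direction \<open>g\<close>
  is additive, and if \<open>g z = 0\<close> then adding \<open>z\<close> leaves \<open>g\<close>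
  unchanged, so any unit vector serves.\<close>

lemma is_seminorm_unit_growth_direction:
  assumes g: "is_seminorm g" and nz: "\<exists>x. g x \<noteq> 0"
  obtains u where "g u = 1" "\<And>t. t \<ge> 0 \<Longrightarrow> g (z + t *\<^sub>R u) = g z + t"
proof (cases "g z = 0")
  case True
  obtain x where "g x \<noteq> 0" using nz by blast
  then have x: "g x > 0" using is_seminorm_nonneg[OF g, of x] by simp
  define u where "u = inverse (g x) *\<^sub>R x"
  have u: "g u = 1" using x by (simp add: u_def is_seminorm_scaleR[OF g])
  have "g (z + t *\<^sub>R u) = g z + t" if "t \<ge> 0" for t
  proof (rule antisym)
    show "g (z + t *\<^sub>R u) \<le> g z + t"
      using is_seminorm_triangle[OF g, of z "t *\<^sub>R u"] that u
      by (simp add: is_seminorm_scaleR[OF g])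
    \<comment> \<open>Subtracting \<open>z\<close> again costs \<open>g (- z) = 0\<close>, so
      \<open>t = g (t *\<^sub>R u)\<close> is at most the right-hand side.\<close>
    show "g z + t \<le> g (z + t *\<^sub>R u)"
      using is_seminorm_triangle[OF g, of "z + t *\<^sub>R u" "- z"] that u True
      by (simp add: is_seminorm_scaleR[OF g] is_seminorm_minus[OF g])
  qed
  with u show ?thesis using that by blast
next
  case False
  then have z: "g z > 0" using is_seminorm_nonneg[OF g, of z] by simp
  define u where "u = inverse (g z) *\<^sub>R z"
  have "g u = 1" using z by (simp add: u_def is_seminorm_scaleR[OF g])
  moreover have "g (z + t *\<^sub>R u) = g z + t" if "t \<ge> 0" for t
  proof -
    have "z + t *\<^sub>R u = (1 + t / g z) *\<^sub>R z"
      by (simp add: u_def scaleR_left_distrib divide_inverse)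
    then show ?thesis using z that by (simp add: is_seminorm_scaleR[OF g] field_simps)
  qed
  ultimately show ?thesis using that by blast
qed

lemma outer_product_mult_vector:
  fixes u :: "real ^ 'm" and p x :: "real ^ 'n"
  shows "(\<chi> i j. u $ i * p $ j) *v x = (p \<bullet> x) *\<^sub>R u"
  by (simp add: vec_eq_iff matrix_vector_mult_def inner_vec_def sum_distrib_left mult_ac)

theorem theorem1:
  fixes lam :: real
    and g :: "real ^ 'm \<Rightarrow> real"
    and h :: "real ^ 'n \<Rightarrow> real"
    and z :: "real ^ 'm"
    and \<beta> :: "real ^ 'n"
  assumes "lam > 0"
    and "is_seminorm g"
    and "\<exists>x. g x \<noteq> 0"
    and "is_norm h"
  shows "is_maximum {g (z + \<Delta> *v \<beta>) | \<Delta>. \<Delta> \<in> uncertainty_set lam h g} (g z + lam * h \<beta>)"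
proof -
  note mem = mem_uncertainty_set_iff[OF assms(2,4)]
  have h: "is_seminorm h" using assms(4) by (simp add: is_norm_def)
  obtain p where p: "p \<bullet> \<beta> = h \<beta>" "\<And>x. \<bar>p \<bullet> x\<bar> \<le> h x"
    using is_seminorm_supporting_functional[OF h] by blast
  obtain u where u: "g u = 1" "\<And>t. t \<ge> 0 \<Longrightarrow> g (z + t *\<^sub>R u) = g z + t"
    using is_seminorm_unit_growth_direction[OF assms(2,3)] by blast
  define D :: "real ^ 'n ^ 'm" where "D = (\<chi> i j. (lam *\<^sub>R u) $ i * p $ j)"
  have D: "D *v x = (lam * (p \<bullet> x)) *\<^sub>R u" for x
    unfolding D_def outer_product_mult_vector by simp
  \<comment> \<open>Since \<open>g u = 1\<close>, \<open>g (D *v x)\<close> equals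
    \<open>lam * \<bar>p \<bullet> x\<bar>\<close>, which is why \<open>p\<close> is needed with a
    two-sided bound.\<close>
  have "D \<in> uncertainty_set lam h g"
    using p(2) assms(1) u(1) by (simp add: mem D is_seminorm_scaleR[OF assms(2)] abs_mult)
  \<comment> \<open>As \<open>p \<bullet> \<beta> = h \<beta>\<close>, \<open>D\<close> moves
    \<open>z\<close> by exactly \<open>lam * h \<beta>\<close> along \<open>u\<close>.\<close>
  moreover have "g (z + D *v \<beta>) = g z + lam * h \<beta>"
    using u(2)[of "lam * h \<beta>"] assms(1) is_seminorm_nonneg[OF h, of \<beta>] by (simp add: D p(1))
  moreover have "g (z + \<Delta> *v \<beta>) \<le> g z + lam * h \<beta>" if "\<Delta> \<in> uncertainty_set lam h g" for \<Delta>
    using is_seminorm_triangle[OF assms(2), of z "\<Delta> *v \<beta>"] that mem by (meson add_left_mono order_trans)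
  ultimately show ?thesis
    unfolding is_maximum_def by (auto intro!: exI[of _ D])
qed

end
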